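(* Let $p/q$ be a rational number in lowest terms with $0 < p/q < 1/2$, and let $p/q = [a_1, \dots, a_m]$ be its continued fraction expansion (with $a_m \ge 2$). For $l = 1, \dots, m-1$ let $s^{(l)}$ be the denominator of the continued fraction $$\frac{r^{(l)}}{s^{(l)}} = [a_{l+1}-1, a_{l+2}, \dots, a_m],$$ written in lowest terms. Then the degree distribution $P(k,p/q)$ of the Haros graph $G_{p/q}$ is $$P\left(k,\frac{p}{q}\right)=\begin{cases} p/q, & k=2,\\ (q-2p)/q, & k=3,\\ 0, & k=4,\\ s^{(l)}/q, & k=\sum_{i=1}^{l} a_i+3 \text{ for some } l\in\{1,\dots,m-1\},\\ 1/q, & k=\sum_{i=1}^{m} a_i+2,\\ 0, & \text{otherwise.}\end{cases}$$
   Context: Continued fractions: $[a_1,\dots,a_m]$ denotes $\cfrac{1}{a_1+\cfrac{1}{a_2+\cdots+\cfrac{1}{a_m}}}$. A rational in $(0,1)$ is expanded with positive integers $a_i$ and with last term $a_m\ge 2$, so that the expansion is unique. In $[a_{l+1}-1,a_{l+2},\dots,a_m]$ the first entry may be $0$ (only when $l+1<m$); the value is still given by the same formula. Equivalently, its denominator is the continuant $K(a_{l+1}-1,a_{l+2},\dots,a_m)$, where $K()=1$, $K(x_1)=x_1$, and $K(x_1,\dots,x_n)=x_nK(x_1,\dots,x_{n-1})+K(x_1,\dots,x_{n-2})$ for $n\ge 2$. Haros graphs: these are finite simple graphs whose nodes are linearly ordered, so that each has a first and a last node (the extreme nodes). The initial graph $G_0$ consists of two nodes joined by an edge, and $G_{0/1}=G_{1/1}=G_0$.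 The concatenation $G_L\oplus G_R$ is obtained from disjoint copies of $G_L$ and $G_R$ by identifying the last node of $G_L$ with the first node of $G_R$ (the degrees add), and then adding one new edge joining the first node of $G_L$ to the last node of $G_R$; the nodes of $G_L$ are ordered before those of $G_R$. Every reduced fraction $p/q\in(0,1)$ is uniquely the mediant $p/q=(a+c)/(b+d)$ of two reduced fractions $a/b<c/d$ in $[0,1]$ with $p=a+c$, $q=b+d$ and $bc-ad=1$ (its parents in the Farey binary tree, with starting fractions $0/1$ and $1/1$). One defines recursively $G_{p/q}=G_{a/b}\oplus G_{c/d}$. The graph $G_{p/q}$ has $q+1$ nodes. Degree distribution (boundary node convention): the first and last nodes of $G_{p/q}$ are identified as a single boundary node whose degree is defined to be the sum of the degrees of the two extreme nodes in $G_{p/q}$; the other nodes keep their degree. This gives $q$ nodes in total, and $P(k,p/q)$ is the number of these $q$ nodes having degree $k$, divided by $q$. *)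

theory Defs
  imports Complex_Main "HOL-Number_Theory.Cong"
begin

section \<open>Continued fractions\<close>

text \<open>
  \<open>cf_value [a\<^sub>1, \<dots>, a\<^sub>m]\<close> is \<open>1/(a\<^sub>1 + 1/(a\<^sub>2 + \<dots> + 1/a\<^sub>m))\<close>.  A leading entry \<open>0\<close> of a
  longer list is harmless: \<open>cf_value (0 # x # xs) = x + cf_value xs\<close>.
\<close>

fun cf_value :: "nat list \<Rightarrow> rat" where
  "cf_value [] = 0"
| "cf_value (x # xs) = 1 / (of_nat x + cf_value xs)"


section \<open>Graphs with linearly ordered nodes\<close>

text \<open>
  The nodes of \<open>G\<close> are \<open>0 < 1 < \<dots> < last_node G\<close>, so a finite graph with linearly ordered
  nodes has exactly one representative up to order isomorphism.  Edges are two-element sets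
  of nodes.
\<close>

datatype ordered_graph = Ordered_Graph (last_node: nat) (edges: "nat set set")

definition nodes :: "ordered_graph \<Rightarrow> nat set" where
  "nodes G = {0..last_node G}"

definition degree :: "ordered_graph \<Rightarrow> nat \<Rightarrow> nat" where
  "degree G v = card {e \<in> edges G. v \<in> e}"

definition simple_graph :: "ordered_graph \<Rightarrow> bool" where
  "simple_graph G \<longleftrightarrow> (\<forall>e \<in> edges G. e \<subseteq> nodes G \<and> card e = 2)"

definition initial_graph :: ordered_graph where
  "initial_graph = Ordered_Graph 1 {{0, 1}}"

text \<open>
  Shifting the nodes of the right graph by \<open>last_node G\<close> makes its first node coincide with
  the last node of the left graph, and nothing else.
\<close>

definition concat_graph :: "ordered_graph \<Rightarrow> ordered_graph \<Rightarrow> ordered_graph" where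
  "concat_graph G H = Ordered_Graph (last_node G + last_node H)
     (edges G \<union> (\<lambda>e. (\<lambda>v. v + last_node G) ` e) ` edges H \<union> {{0, last_node G + last_node H}})"


section \<open>Haros graphs\<close>

text \<open>
  \<open>a/b\<close> and \<open>c/d\<close> are the parents of \<open>p/q\<close>.  The last condition is \<open>b c - a d = 1\<close>, written
  without truncated subtraction; it entails \<open>a/b < c/d\<close>.
\<close>

definition is_farey_parents :: "nat \<Rightarrow> nat \<Rightarrow> nat \<times> nat \<times> nat \<times> nat \<Rightarrow> bool" where
  "is_farey_parents p q = (\<lambda>(a, b, c, d).
     0 < b \<and> a \<le> b \<and> coprime a b \<and> 0 < d \<and> c \<le> d \<and> coprime c d \<and>
     p = a + c \<and> q = b + d \<and> b * c = a * d + 1)"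

lemma is_farey_parents_exists:
  assumes "0 < p" "p < q" "coprime p q"
  shows "\<exists>x. is_farey_parents p q x"
proof -
  obtain x where x: "[p * x = 1] (mod q)"
    using cong_solve_coprime_nat[OF assms(3)] by auto
  define b where "b = x mod q"
  have q: "1 < q" using assms by simp
  have "[p * b = 1] (mod q)"
    using x unfolding b_def cong_def by (simp add: mod_mult_right_eq)
  then have m1: "(p * b) mod q = 1"
    using q by (simp add: cong_def)
  define a where "a = (p * b) div q"
  have pb: "p * b = a * q + 1"
    using m1 unfolding a_def by (metis div_mult_mod_eq)
  have b: "0 < b" using pb by (cases b) auto
  have bq: "b < q" unfolding b_def using q by simp
  have "a * q < p * q"
    using pb bq assms(1) by (metis add_lessD1 less_add_one mult_less_mono2 order.strict_trans)
  then have ap: "a < p" by simp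
  have "a * q < b * q"
    using pb assms(2) b by (metis less_add_one mult.commute mult_less_mono2 order.strict_trans)
  then have ab: "a < b" by simp
  define c where "c = p - a"
  define d where "d = q - b"
  have pc: "p = a + c" and qd: "q = b + d" and d: "0 < d" and c: "0 < c"
    using ap bq by (auto simp: c_def d_def)
  have det: "b * c = a * d + 1"
    using pb unfolding pc qd by (simp add: algebra_simps)
  have cd: "c \<le> d"
  proof (rule ccontr)
    assume "\<not> c \<le> d"
    then have "b * (d + 1) \<le> b * c" by (intro mult_le_mono2) simp
    moreover have "a * d \<le> b * d" using ab by simp
    ultimately have "b \<le> 1" using det by (simp only: distrib_left mult_1_right)
    then have "b = 1" "a = 0" using ab b by auto
    then have "c = 1" using det by simp
    then show False using \<open>\<not> c \<le> d\<close> d by simp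
  qed
  have "coprime a b"
  proof (rule coprimeI)
    fix k assume "k dvd a" "k dvd b"
    then have "k dvd b * c" "k dvd a * d" by auto
    then show "is_unit k" using det by (metis dvd_add_right_iff)
  qed
  moreover have "coprime c d"
  proof (rule coprimeI)
    fix k assume "k dvd c" "k dvd d"
    then have "k dvd b * c" "k dvd a * d" by auto
    then show "is_unit k" using det by (metis dvd_add_right_iff)
  qed
  ultimately have "is_farey_parents p q (a, b, c, d)"
    using b ab d cd pc qd det by (simp add: is_farey_parents_def)
  then show ?thesis by blast
qed

lemma is_farey_parents_unique:
  assumes "is_farey_parents p q x" "is_farey_parents p q y"
  shows "x = y"
proof -
  obtain a b c d where x: "x = (a, b, c, d)" by (cases x) auto
  obtain a' b' c' d' where y: "y = (a', b', c', d')" by (cases y) auto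
  have h: "0 < b" "0 < d" "p = a + c" "q = b + d" "b * c = a * d + 1"
      "0 < b'" "0 < d'" "p = a' + c'" "q = b' + d'" "b' * c' = a' * d' + 1"
    using assms unfolding x y is_farey_parents_def by auto
  have 1: "p * b = a * q + 1"
    using h(5) unfolding h(3,4) by (simp add: algebra_simps)
  have 2: "p * b' = a' * q + 1"
    using h(10) unfolding h(8,9) by (simp add: algebra_simps)
  have cop: "coprime p q"
  proof (rule coprimeI)
    fix k assume "k dvd p" "k dvd q"
    then have "k dvd p * b" "k dvd a * q" by auto
    then show "is_unit k" using 1 by (metis dvd_add_right_iff)
  qed
  have "[p * b = p * b'] (mod q)"
    unfolding 1 2 cong_def by (metis add.commute mod_mult_self1)
  then have "[b = b'] (mod q)"
    using cop by (simp add: cong_mult_lcancel_nat)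
  moreover have "b < q" "b' < q" using h(2,4,7,9) by auto
  ultimately have b: "b = b'" by (simp add: cong_def)
  then have "a * q = a' * q" using 1 2 by (metis add_right_cancel)
  then have "a = a'" using h(1,4) by simp
  then show ?thesis using b h(3,4,8,9) x y by simp
qed

definition farey_parents :: "nat \<Rightarrow> nat \<Rightarrow> nat \<times> nat \<times> nat \<times> nat" where
  "farey_parents p q = (THE x. is_farey_parents p q x)"

lemma farey_parents_eq:
  "is_farey_parents p q x \<Longrightarrow> farey_parents p q = x"
  unfolding farey_parents_def by (blast intro: is_farey_parents_unique)

lemma farey_parents:
  assumes "0 < p" "p < q" "coprime p q"
  shows "is_farey_parents p q (farey_parents p q)"
  using is_farey_parents_exists[OF assms] farey_parents_eq by metis

lemma farey_parents_less:
  assumes "(a, b, c, d) = farey_parents p q" "0 < p" "p < q" "coprime p q"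
  shows "b < q" and "d < q"
  using farey_parents[OF assms(2-4)] unfolding assms(1)[symmetric]
  by (auto simp: is_farey_parents_def)

text \<open>
  \<open>haros_graph p q\<close> is \<open>G\<^bsub>p/q\<^esub>\<close> for \<open>p/q\<close> in lowest terms in \<open>[0, 1]\<close>; the value on any other
  pair is irrelevant.
\<close>

function haros_graph :: "nat \<Rightarrow> nat \<Rightarrow> ordered_graph" where
  "haros_graph p q =
     (if 0 < p \<and> p < q \<and> coprime p q
      then case farey_parents p q of
             (a, b, c, d) \<Rightarrow> concat_graph (haros_graph a b) (haros_graph c d)
      else initial_graph)"
  by pat_completeness auto
termination
  by (relation "measure snd") (use farey_parents_less in auto)

declare haros_graph.simps [simp del]

lemma haros_graph_0_1: "haros_graph 0 1 = initial_graph"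
  and haros_graph_1_1: "haros_graph 1 1 = initial_graph"
  by (simp_all add: haros_graph.simps)

lemma haros_graph_mediant:
  assumes "0 < p" "p < q" "coprime p q" "is_farey_parents p q (a, b, c, d)"
  shows "haros_graph p q = concat_graph (haros_graph a b) (haros_graph c d)"
  using assms farey_parents_eq[OF assms(4)] by (subst haros_graph.simps) simp

lemma last_node_haros_graph:
  assumes "p \<le> q" "coprime p q"
  shows "last_node (haros_graph p q) = q"
  using assms
proof (induction q arbitrary: p rule: less_induct)
  case (less q)
  show ?case
  proof (cases "0 < p \<and> p < q")
    case False
    then have "q = 1" using less.prems by auto
    then show ?thesis using False
      by (subst haros_graph.simps) (auto simp: initial_graph_def)
  next
    case True
    obtain a b c d where par: "is_farey_parents p q (a, b, c, d)"
      using is_farey_parents_exists[of p q] True less.prems by auto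
    then show ?thesis
      using haros_graph_mediant[OF _ _ _ par] True less.prems less.IH[of b a] less.IH[of d c]
      by (auto simp: is_farey_parents_def concat_graph_def)
  qed
qed

lemma simple_graph_concat:
  assumes "simple_graph G" "simple_graph H" "0 < last_node G"
  shows "simple_graph (concat_graph G H)"
  using assms
  by (fastforce simp: simple_graph_def concat_graph_def nodes_def card_image inj_on_def)

lemma simple_haros_graph:
  "simple_graph (haros_graph p q) \<and> 0 < last_node (haros_graph p q)"
proof (induction p q rule: haros_graph.induct)
  case (1 p q)
  show ?case
  proof (cases "0 < p \<and> p < q \<and> coprime p q")
    case False
    then show ?thesis
      by (subst (1 2) haros_graph.simps)
        (auto simp: initial_graph_def simple_graph_def nodes_def)
  next
    case True
    obtain a b c d where par: "farey_parents p q = (a, b, c, d)"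
      by (cases "farey_parents p q") auto
    have eq: "haros_graph p q = concat_graph (haros_graph a b) (haros_graph c d)"
      using True par by (subst haros_graph.simps) simp
    show ?thesis
      using 1[OF True par[symmetric] refl refl] simple_graph_concat
      unfolding eq by (auto simp: concat_graph_def)
  qed
qed


section \<open>Degree distribution with the boundary node convention\<close>

text \<open>
  After identifying the two extreme nodes, the nodes are represented by
  \<open>0, \<dots>, last_node G - 1\<close>, where \<open>0\<close> stands for the boundary node.
\<close>

definition boundary_degree :: "ordered_graph \<Rightarrow> nat \<Rightarrow> nat" where
  "boundary_degree G v =
     (if v = 0 then degree G 0 + degree G (last_node G) else degree G v)"

definition degree_distribution :: "nat \<Rightarrow> nat \<Rightarrow> nat \<Rightarrow> rat" where
  "degree_distribution k p q =
     of_nat (card {v \<in> {..<last_node (haros_graph p q)}. boundary_degree (haros_graph p q) v = k})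
       / of_nat q"

end

theory Submission
  imports Defs
begin

text \<open>
  A Haros graph is built by repeated concatenation, and a concatenation changes few degrees: it
  adds one to each extreme degree and turns the two glued extreme nodes into one interior node.
  So the interior degrees of a mediant are those of its two parents together with one new value,
  the degree of the glued node, and everything is governed by the extreme degrees.

  In terms of continued fractions, \<open>[a\<^sub>1, \<dots>, a\<^sub>j, n + 1]\<close> has the parents \<open>[a\<^sub>1, \<dots>, a\<^sub>j]\<close> and
  \<open>[a\<^sub>1, \<dots>, a\<^sub>j, n]\<close>, in an order that depends on the parity of \<open>j\<close>
  (\<open>cf_graph_snoc_Suc\<close>). The latter is the newer of the two and itself a child of the
  former, unless their mediant is \<open>1/2\<close>. Hence the boundary degree, the sum of the extreme
  degrees, grows by one with each level of the Farey tree, and for all fractions up to \<open>1/2\<close> it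
  equals \<open>a\<^sub>1 + \<dots> + a\<^sub>m + 2\<close> (\<open>boundary_degree_sum\<close>); and the glued node has one degree more than the boundary
  node of the older parent, that is \<open>a\<^sub>1 + \<dots> + a\<^sub>j + 3\<close>. If \<open>N\<^sub>k\<close> counts the interior nodes of
  degree \<open>k\<close>, then
  \<open>N\<^sub>k[a\<^sub>1, \<dots>, a\<^sub>j, n + 1] = N\<^sub>k[a\<^sub>1, \<dots>, a\<^sub>j, n] + N\<^sub>k[a\<^sub>1, \<dots>, a\<^sub>j]\<close>, plus one when
  \<open>k = a\<^sub>1 + \<dots> + a\<^sub>j + 3\<close> (\<open>interior_count_snoc_Suc\<close>).

  Continuants obey the same recursion in their last entry. For fixed \<open>l\<close>, the denominator of
  \<open>[a\<^bsub>l+1\<^esub> - 1, a\<^bsub>l+2\<^esub>, \<dots>]\<close> is additive as soon as the last entry lies beyond \<open>a\<^bsub>l+1\<^esub>\<close>, and grows by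
  one with \<open>n\<close> while \<open>a\<^bsub>l+1\<^esub> = n\<close> is itself the last entry. The counts \<open>p\<close> for degree two and
  \<open>q - 2 p\<close> for degree three follow the recursion as well, so comparing initial values
  proves \<open>interior_count_closed_form\<close>. The boundary node contributes the single
  remaining degree \<open>a\<^sub>1 + \<dots> + a\<^sub>m + 2\<close>, which differs from all the interior ones because
  \<open>a\<^sub>m \<ge> 2\<close>.
\<close>


section \<open>Degrees in a concatenation\<close>

definition interior_count :: "ordered_graph \<Rightarrow> nat \<Rightarrow> nat" where
  "interior_count G k = card {v \<in> {0<..<last_node G}. degree G v = k}"

lemma last_node_concat_graph [simp]:
  "last_node (concat_graph G H) = last_node G + last_node H"
  by (simp add: concat_graph_def)

lemma finite_edges:
  assumes "simple_graph G"
  shows "finite (edges G)"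
proof -
  have "edges G \<subseteq> Pow (nodes G)"
    using assms by (auto simp: simple_graph_def)
  then show ?thesis
    by (rule finite_subset) (simp add: nodes_def)
qed

lemma degree_beyond_last_node:
  assumes "simple_graph G" "last_node G < v"
  shows "degree G v = 0"
proof -
  have "{e \<in> edges G. v \<in> e} = {}"
    using assms by (force simp: simple_graph_def nodes_def)
  then show ?thesis
    unfolding degree_def by (simp only: card.empty)
qed

text \<open>
  The degree of a node is zero outside the graph, so one formula covers the nodes of the left
  graph, those of the right graph and the glued node. The three sets of edges are disjoint: the
  glued graphs share a single node, and the new edge spans both of them.
\<close>

lemma degree_concat_graph:
  assumes G: "simple_graph G" "0 < last_node G" and H: "simple_graph H" "0 < last_node H"
  shows "degree (concat_graph G H) v =
           degree G v
           + (if last_node G \<le> v then degree H (v - last_node G) else 0)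
           + (if v = 0 \<or> v = last_node G + last_node H then 1 else 0)"
proof -
  define n where "n = last_node G"
  define w where "w = last_node G + last_node H"
  define S where "S = (\<lambda>e. (\<lambda>u. u + n) ` e) ` edges H"
  have S_ge: "n \<le> u" if "e \<in> S" "u \<in> e" for e u
    using that by (auto simp: S_def)
  have S_card: "card e = 2" if "e \<in> S" for e
    using that H(1) by (auto simp: S_def simple_graph_def card_image)
  have G_le: "u \<le> n" if "e \<in> edges G" "u \<in> e" for e u
    using that G(1) by (fastforce simp: simple_graph_def nodes_def n_def)
  have GS: "edges G \<inter> S = {}"
  proof (rule ccontr)
    assume "edges G \<inter> S \<noteq> {}"
    then obtain e where e: "e \<in> edges G" "e \<in> S" by auto
    then have "e \<subseteq> {n}" using S_ge G_le by (auto intro: antisym)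
    then have "card e \<le> 1" by (metis card.empty card.insert card_mono empty_iff finite.emptyI finite.insertI One_nat_def)
    then show False using S_card[OF e(2)] by simp
  qed
  have newG: "{0, w} \<notin> edges G"
    using G_le[of "{0, w}" w] H(2) by (auto simp: w_def n_def)
  have newS: "{0, w} \<notin> S"
    using S_ge[of "{0, w}" 0] G(2) by (auto simp: n_def)
  have fin: "finite (edges G)" "finite S"
    using finite_edges[OF G(1)] finite_edges[OF H(1)] by (auto simp: S_def)
  have "{e \<in> edges (concat_graph G H). v \<in> e} =
          {e \<in> edges G. v \<in> e} \<union> ({e \<in> S. v \<in> e} \<union> {e \<in> {{0, w}}. v \<in> e})"
    by (auto simp: concat_graph_def S_def n_def w_def)
  then have "degree (concat_graph G H) v =
      card ({e \<in> edges G. v \<in> e} \<union> ({e \<in> S. v \<in> e} \<union> {e \<in> {{0, w}}. v \<in> e}))"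
    by (simp add: degree_def)
  also have "\<dots> = card {e \<in> edges G. v \<in> e} + card ({e \<in> S. v \<in> e} \<union> {e \<in> {{0, w}}. v \<in> e})"
    using fin GS newG by (intro card_Un_disjoint) auto
  also have "card ({e \<in> S. v \<in> e} \<union> {e \<in> {{0, w}}. v \<in> e}) =
      card {e \<in> S. v \<in> e} + card {e \<in> {{0, w}}. v \<in> e}"
    using fin newS by (intro card_Un_disjoint) auto
  also have "card {e \<in> {{0, w}}. v \<in> e} = (if v = 0 \<or> v = w then 1 else 0)"
  proof -
    have "{e \<in> {{0, w}}. v \<in> e} = (if v = 0 \<or> v = w then {{0, w}} else {})" by auto
    then show ?thesis by simp
  qed
  also have "card {e \<in> S. v \<in> e} = (if n \<le> v then degree H (v - n) else 0)"
  proof (cases "n \<le> v")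
    case True
    have inj: "inj_on (\<lambda>e. (\<lambda>u. u + n) ` e) A" for A :: "nat set set"
      by (rule inj_onI) (simp add: inj_image_eq_iff)
    have "v \<in> (\<lambda>u. u + n) ` e \<longleftrightarrow> v - n \<in> e" for e
      using True by (force simp: image_iff)
    then have "{e \<in> S. v \<in> e} = (\<lambda>e. (\<lambda>u. u + n) ` e) ` {e \<in> edges H. v - n \<in> e}"
      by (auto simp: S_def)
    then show ?thesis
      using True by (simp add: card_image[OF inj] degree_def)
  next
    case False
    then have "{e \<in> S. v \<in> e} = {}" using S_ge by auto
    then show ?thesis using False by (simp only: card.empty if_False)
  qed
  finally show ?thesis
    by (simp add: degree_def n_def w_def)
qed

text \<open>
  Extreme nodes other than the glued pair stay extreme, so the glued node is the only new
  interior node, and interior nodes gain no edge.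
\<close>

lemma interior_count_concat_graph:
  assumes G: "simple_graph G" "0 < last_node G" and H: "simple_graph H" "0 < last_node H"
  shows "interior_count (concat_graph G H) k =
           interior_count G k + interior_count H k
           + (if k = degree G (last_node G) + degree H 0 then 1 else 0)"
proof -
  define n where "n = last_node G"
  define A where "A = {v \<in> {0<..<n}. degree G v = k}"
  define B where "B = {v \<in> {0<..<last_node H}. degree H v = k}"
  define C where "C = (if k = degree G n + degree H 0 then {n} else {})"
  note deg = degree_concat_graph[OF assms, folded n_def]
  have "{v \<in> {0<..<last_node (concat_graph G H)}. degree (concat_graph G H) v = k}
      = A \<union> ((\<lambda>v. v + n) ` B \<union> C)" (is "?I = _")
  proof (intro set_eqI)
    fix v
    consider "v < n" | "v = n" | u where "v = u + n" "0 < u"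
      by (metis add.commute less_imp_add_positive linorder_neqE_nat)
    then show "v \<in> ?I \<longleftrightarrow> v \<in> A \<union> ((\<lambda>v. v + n) ` B \<union> C)"
    proof cases
      case 1
      then show ?thesis using H(2) by (auto simp: deg A_def C_def n_def split: if_splits)
    next
      case 2
      then show ?thesis using G(2) H(2) by (auto simp: deg A_def B_def C_def n_def)
    next
      case 3
      then have "degree G v = 0"
        using degree_beyond_last_node[OF G(1)] by (simp add: n_def)
      then show ?thesis using 3 G(2) by (auto simp: deg A_def B_def C_def n_def)
    qed
  qed
  then have "interior_count (concat_graph G H) k = card (A \<union> ((\<lambda>v. v + n) ` B \<union> C))"
    by (simp only: interior_count_def)
  also have "\<dots> = card A + card ((\<lambda>v. v + n) ` B \<union> C)"
    by (rule card_Un_disjoint) (auto simp: A_def B_def C_def)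
  also have "card ((\<lambda>v. v + n) ` B \<union> C) = card ((\<lambda>v. v + n) ` B) + card C"
    by (rule card_Un_disjoint) (auto simp: B_def C_def)
  also have "card ((\<lambda>v. v + n) ` B) = card B"
    by (simp add: card_image)
  finally show ?thesis
    by (simp add: A_def B_def C_def interior_count_def n_def)
qed

lemma degree_concat_graph_first:
  assumes "simple_graph G" "0 < last_node G" "simple_graph H" "0 < last_node H"
  shows "degree (concat_graph G H) 0 = degree G 0 + 1"
  using assms by (simp add: degree_concat_graph)

lemma degree_concat_graph_last:
  assumes "simple_graph G" "0 < last_node G" "simple_graph H" "0 < last_node H"
  shows "degree (concat_graph G H) (last_node G + last_node H) = degree H (last_node H) + 1"
  using assms by (simp add: degree_concat_graph degree_beyond_last_node)

lemma card_boundary_degree: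
  assumes "0 < last_node G"
  shows "card {v \<in> {..<last_node G}. boundary_degree G v = k} =
           interior_count G k + (if k = degree G 0 + degree G (last_node G) then 1 else 0)"
proof -
  let ?C = "if k = degree G 0 + degree G (last_node G) then {0 :: nat} else {}"
  have "{v \<in> {..<last_node G}. boundary_degree G v = k}
      = {v \<in> {0<..<last_node G}. degree G v = k} \<union> ?C"
    using assms by (auto simp: boundary_degree_def split: if_splits)
  moreover have "card ({v \<in> {0<..<last_node G}. degree G v = k} \<union> ?C)
      = card {v \<in> {0<..<last_node G}. degree G v = k} + card ?C"
    by (intro card_Un_disjoint) auto
  ultimately show ?thesis
    by (simp add: interior_count_def)
qed


section \<open>Continuants\<close>

text \<open>
  Numerator and denominator of \<open>cf_value\<close> in lowest terms. They are defined on all lists, since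
  the mediant recursion also passes through expansions that end in \<open>1\<close>.
\<close>

fun cf_num :: "nat list \<Rightarrow> nat" and cf_den :: "nat list \<Rightarrow> nat" where
  "cf_num [] = 0"
| "cf_num (x # xs) = cf_den xs"
| "cf_den [] = 1"
| "cf_den (x # xs) = x * cf_den xs + cf_num xs"

text \<open>
  Both continuants are affine functions of the last entry, whose slopes are the continuants of
  the list without it: this is the mediant step on numerators and denominators.
\<close>

lemma cf_snoc_Suc:
  "cf_num (xs @ [Suc n]) = cf_num (xs @ [n]) + cf_num xs"
  "cf_den (xs @ [Suc n]) = cf_den (xs @ [n]) + cf_den xs"
  by (induction xs) (auto simp: algebra_simps)

text \<open>
  The two expansions \<open>[\<dots>, n, 1]\<close> and \<open>[\<dots>, n + 1]\<close> of the same number.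
\<close>

lemma cf_snoc_one:
  "cf_num (xs @ [n, 1]) = cf_num (xs @ [Suc n])"
  "cf_den (xs @ [n, 1]) = cf_den (xs @ [Suc n])"
  by (induction xs) auto

text \<open>
  Putting one more entry in front inverts both fractions and so exchanges their order; hence the
  parity.
\<close>

lemma cf_det:
  "if even (length xs)
   then cf_den xs * cf_num (xs @ [n]) = cf_num xs * cf_den (xs @ [n]) + 1
   else cf_den (xs @ [n]) * cf_num xs = cf_num (xs @ [n]) * cf_den xs + 1"
  by (induction xs) (auto simp: algebra_simps split: if_splits)

lemma coprime_cf: "coprime (cf_num xs) (cf_den xs)"
proof (induction xs)
  case (Cons x xs)
  then show ?case
    using gcd_add_mult[of "cf_den xs" x "cf_num xs"]
    by (simp add: coprime_iff_gcd_eq_1 gcd.commute)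
qed simp

lemma cf_den_pos: "\<forall>x\<in>set xs. 1 \<le> x \<Longrightarrow> 0 < cf_den xs"
  by (induction xs) auto

lemma cf_num_le_den: "\<forall>x\<in>set xs. 1 \<le> x \<Longrightarrow> cf_num xs \<le> cf_den xs"
proof (cases xs)
  case (Cons x ys)
  assume "\<forall>x\<in>set xs. 1 \<le> x"
  then have "1 * cf_den ys \<le> x * cf_den ys"
    using Cons by (intro mult_le_mono1) simp
  then show ?thesis unfolding Cons cf_num.simps cf_den.simps by linarith
qed simp

lemma cf_value_eq:
  "\<forall>x\<in>set xs. 1 \<le> x \<Longrightarrow> cf_value xs = of_nat (cf_num xs) / of_nat (cf_den xs)"
proof (induction xs)
  case (Cons x xs)
  then have eq: "cf_value xs = of_nat (cf_num xs) / of_nat (cf_den xs)" and "0 < cf_den xs"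
    using cf_den_pos[of xs] by auto
  then show ?case by (simp add: eq[simplified] divide_simps)
qed simp

lemma cf_value_Cons_eq:
  assumes "\<forall>x\<in>set xs. 1 \<le> x"
  shows "cf_value (x # xs) = of_nat (cf_num (x # xs)) / of_nat (cf_den (x # xs))"
  using cf_den_pos[OF assms] by (simp add: cf_value_eq[OF assms] divide_simps)

lemma quotient_of_divide_nat:
  assumes "coprime m n" "0 < n"
  shows "quotient_of (of_nat m / of_nat n) = (int m, int n)"
proof -
  have "(of_nat m / of_nat n :: rat) = Fract (int m) (int n)"
    by (simp add: Fract_of_int_quotient)
  then show ?thesis
    using assms by (simp add: quotient_of_Fract Rat.normalize_def Let_def)
qed


section \<open>Haros graphs along a continued fraction\<close>

definition cf_graph :: "nat list \<Rightarrow> ordered_graph" where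
  "cf_graph xs = haros_graph (cf_num xs) (cf_den xs)"

lemma cf_graph_snoc_one: "cf_graph (xs @ [n, 1]) = cf_graph (xs @ [Suc n])"
  by (simp only: cf_graph_def cf_snoc_one)

lemma simple_cf_graph [simp]: "simple_graph (cf_graph xs)" "0 < last_node (cf_graph xs)"
  using simple_haros_graph by (auto simp: cf_graph_def)

text \<open>
  The determinant condition already makes the mediant a reduced fraction strictly between
  \<open>0\<close> and \<open>1\<close>.
\<close>

lemma haros_graph_farey_parents:
  assumes "is_farey_parents p q (a, b, c, d)"
  shows "haros_graph p q = concat_graph (haros_graph a b) (haros_graph c d)"
proof (rule haros_graph_mediant[OF _ _ _ assms])
  have h: "0 < b" "a \<le> b" "c \<le> d" "p = a + c" "q = b + d" "b * c = a * d + 1"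
    using assms by (auto simp: is_farey_parents_def)
  show "0 < p" using h by (cases c) auto
  have "\<not> (a = b \<and> c = d)" using h(6) by auto
  then show "p < q" using h by linarith
  show "coprime p q"
  proof (rule coprimeI)
    fix k assume k: "k dvd p" "k dvd q"
    have "p * b = a * q + 1" using h(6) unfolding h(4,5) by (simp add: algebra_simps)
    moreover have "k dvd p * b" "k dvd a * q" using k by auto
    ultimately show "is_unit k" by (metis dvd_add_right_iff)
  qed
qed

text \<open>
  The Farey parents of \<open>[\<dots>, n + 1]\<close> are \<open>[\<dots>, n]\<close> and the convergent without the last entry. For
  the empty list this convergent is \<open>0/1\<close>, the left parent of every \<open>1/(n + 1)\<close>.
\<close>

lemma cf_graph_snoc_Suc:
  assumes "\<forall>x\<in>set (xs @ [n]). 1 \<le> x"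
  shows "cf_graph (xs @ [Suc n]) =
    (if even (length xs) then concat_graph (cf_graph xs) (cf_graph (xs @ [n]))
     else concat_graph (cf_graph (xs @ [n])) (cf_graph xs))"
proof -
  have xs: "\<forall>x\<in>set xs. 1 \<le> x" using assms by simp
  note facts = cf_den_pos[OF xs] cf_den_pos[OF assms] cf_num_le_den[OF xs] cf_num_le_den[OF assms]
    coprime_cf cf_snoc_Suc[of xs n] cf_det[of xs n]
  show ?thesis
  proof (cases "even (length xs)")
    case True
    then have "is_farey_parents (cf_num (xs @ [Suc n])) (cf_den (xs @ [Suc n]))
        (cf_num xs, cf_den xs, cf_num (xs @ [n]), cf_den (xs @ [n]))"
      using facts by (simp add: is_farey_parents_def)
    then show ?thesis
      using True by (simp add: cf_graph_def haros_graph_farey_parents)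
  next
    case False
    then have "is_farey_parents (cf_num (xs @ [Suc n])) (cf_den (xs @ [Suc n]))
        (cf_num (xs @ [n]), cf_den (xs @ [n]), cf_num xs, cf_den xs)"
      using facts by (simp add: is_farey_parents_def)
    then show ?thesis
      using False by (simp add: cf_graph_def haros_graph_farey_parents)
  qed
qed

definition first_degree :: "nat list \<Rightarrow> nat" where
  "first_degree xs = degree (cf_graph xs) 0"

definition last_degree :: "nat list \<Rightarrow> nat" where
  "last_degree xs = degree (cf_graph xs) (last_node (cf_graph xs))"

lemma extreme_degrees_snoc_Suc:
  assumes "\<forall>x\<in>set (xs @ [n]). 1 \<le> x"
  shows "even (length xs) \<Longrightarrow> first_degree (xs @ [Suc n]) = first_degree xs + 1"
    and "even (length xs) \<Longrightarrow> last_degree (xs @ [Suc n]) = last_degree (xs @ [n]) + 1"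
    and "odd (length xs) \<Longrightarrow> first_degree (xs @ [Suc n]) = first_degree (xs @ [n]) + 1"
    and "odd (length xs) \<Longrightarrow> last_degree (xs @ [Suc n]) = last_degree xs + 1"
  by (simp_all add: first_degree_def last_degree_def cf_graph_snoc_Suc[OF assms]
      degree_concat_graph_first degree_concat_graph_last)

text \<open>
  The expansions of fractions at most \<open>1/2\<close>, among them the empty one of \<open>0/1\<close>; a last entry \<open>1\<close>
  is admitted. The fraction \<open>1/1\<close> has to be kept out because it belongs to the initial graph
  without being a child of \<open>0/1\<close>, so that its boundary degree is \<open>2\<close> and not \<open>1 + 2\<close>.
\<close>

definition below_half :: "nat list \<Rightarrow> bool" where
  "below_half xs \<longleftrightarrow> (\<forall>x\<in>set xs. 1 \<le> x) \<and> (xs \<noteq> [] \<longrightarrow> 2 \<le> hd xs)"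

lemma below_half_simps:
  "below_half []"
  "below_half [x] \<longleftrightarrow> 2 \<le> x"
  "xs \<noteq> [] \<Longrightarrow> below_half (xs @ [n]) \<longleftrightarrow> below_half xs \<and> 1 \<le> n"
  by (auto simp: below_half_def)

lemma below_half_pos: "below_half xs \<Longrightarrow> \<forall>x\<in>set xs. 1 \<le> x"
  by (simp add: below_half_def)

text \<open>
  Induction along the Farey tree below \<open>1/2\<close>. The last case only rewrites an expansion; it keeps
  the sum of the entries, so the length is added to it to obtain a decreasing measure. The
  fraction \<open>1/2\<close> is a separate start because its parent \<open>1/1\<close> is not of the form considered.
\<close>

lemma below_half_induct [consumes 1, case_names Nil half mediant snoc_one]:
  assumes "below_half xs"
    and "P []" and "P [2]"
    and mediant: "\<And>xs n. below_half xs \<Longrightarrow> below_half (xs @ [n]) \<Longrightarrow> P xs \<Longrightarrow> P (xs @ [n]) \<Longrightarrow> P (xs @ [Suc n])"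
    and snoc_one: "\<And>xs n. below_half (xs @ [n]) \<Longrightarrow> P (xs @ [Suc n]) \<Longrightarrow> P (xs @ [n, 1])"
  shows "P xs"
  using assms(1)
proof (induction "sum_list xs + length xs" arbitrary: xs rule: less_induct)
  case less
  show ?case
  proof (cases xs rule: rev_cases)
    case Nil
    then show ?thesis using assms(2) by simp
  next
    case xs: (snoc ys n)
    show ?thesis
    proof (cases ys rule: rev_cases)
      case Nil
      then have "2 \<le> n" using less.prems xs by (simp add: below_half_simps)
      show ?thesis
      proof (cases "n = 2")
        case True
        then show ?thesis using xs Nil assms(3) by simp
      next
        case False
        then obtain k where k: "n = Suc k" "2 \<le> k" using \<open>2 \<le> n\<close> by (cases n) auto
        then have "P ([] @ [k])" using xs Nil by (intro less.hyps) (auto simp: below_half_simps)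
        then have "P ([] @ [Suc k])"
          using k assms(2) by (intro mediant) (auto simp: below_half_simps)
        then show ?thesis using xs Nil k by simp
      qed
    next
      case ys: (snoc zs j)
      then have adm: "below_half ys" "1 \<le> n"
        using less.prems xs below_half_simps(3)[of ys n] by auto
      show ?thesis
      proof (cases "n = 1")
        case True
        have "below_half (zs @ [Suc j])"
          using adm(1) ys by (cases "zs = []") (auto simp: below_half_simps)
        then have "P (zs @ [Suc j])" using xs ys True by (intro less.hyps) auto
        then show ?thesis using snoc_one[of zs j] xs ys True adm by simp
      next
        case False
        then obtain k where k: "n = Suc k" "1 \<le> k" using adm(2) by (cases n) auto
        have "below_half (ys @ [k])" using adm k ys below_half_simps(3)[of ys k] by simp
        moreover have "P (ys @ [k])" using calculation xs k by (intro less.hyps) auto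
        moreover have "P ys" using adm xs by (intro less.hyps) auto
        ultimately show ?thesis using mediant[of ys k] adm xs k by simp
      qed
    qed
  qed
qed

lemma twice_cf_num_le_den:
  assumes "below_half xs"
  shows "2 * cf_num xs \<le> cf_den xs"
proof (cases xs)
  case (Cons x ys)
  then have "2 * cf_den ys \<le> x * cf_den ys"
    using assms by (intro mult_le_mono1) (simp add: below_half_def)
  then show ?thesis unfolding Cons cf_num.simps cf_den.simps by linarith
qed simp

text \<open>
  Of the parents \<open>xs\<close> and \<open>xs @ [n]\<close> of a mediant, the second is the newer one: it is itself a
  concatenation with a copy of \<open>xs\<close> at one end, and the extreme node at that end has one edge
  more than in \<open>xs\<close>. For \<open>n = 1\<close> this is seen from the shorter expansion.
\<close>

lemma extreme_degrees_newer_parent: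
  assumes "below_half (xs @ [n])"
  shows "even (length xs) \<Longrightarrow> first_degree (xs @ [n]) = first_degree xs + 1"
    and "odd (length xs) \<Longrightarrow> last_degree (xs @ [n]) = last_degree xs + 1"
proof -
  have "(even (length xs) \<longrightarrow> first_degree (xs @ [n]) = first_degree xs + 1) \<and>
        (odd (length xs) \<longrightarrow> last_degree (xs @ [n]) = last_degree xs + 1)"
  proof (cases "n = 1")
    case True
    show ?thesis
    proof (cases xs rule: rev_cases)
      case Nil
      then show ?thesis using assms True by (simp add: below_half_def)
    next
      case (snoc ys j)
      have "\<forall>x\<in>set (ys @ [j]). 1 \<le> x"
        using assms snoc by (simp add: below_half_def)
      from extreme_degrees_snoc_Suc[OF this] show ?thesis
        using snoc True cf_graph_snoc_one[of ys j] by (auto simp: first_degree_def last_degree_def)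
    qed
  next
    case False
    then obtain k where k: "n = Suc k" "1 \<le> k"
      using assms by (cases n) (auto simp: below_half_def)
    then have "\<forall>x\<in>set (xs @ [k]). 1 \<le> x"
      using assms by (auto simp: below_half_def)
    from extreme_degrees_snoc_Suc[OF this] show ?thesis
      using k by simp
  qed
  then show "even (length xs) \<Longrightarrow> first_degree (xs @ [n]) = first_degree xs + 1"
    and "odd (length xs) \<Longrightarrow> last_degree (xs @ [n]) = last_degree xs + 1"
    by auto
qed

lemma cf_graph_Nil: "cf_graph [] = initial_graph"
  and cf_graph_one: "cf_graph [1] = initial_graph"
  by (simp_all add: cf_graph_def haros_graph.simps)

lemma initial_graph_facts:
  "last_node initial_graph = 1" "simple_graph initial_graph"
  "degree initial_graph 0 = 1" "degree initial_graph 1 = 1"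
  "interior_count initial_graph k = 0"
proof -
  have "{e. e = {0, 1} \<and> v \<in> e} = {{0, 1}}" if "v \<le> 1" for v :: nat
    using that by auto
  then show "degree initial_graph 0 = 1" "degree initial_graph 1 = 1"
    by (simp_all add: degree_def initial_graph_def)
  show "last_node initial_graph = 1" "simple_graph initial_graph"
    "interior_count initial_graph k = 0"
    by (auto simp: initial_graph_def simple_graph_def nodes_def interior_count_def
        intro!: arg_cong[where f = card] simp del: card.empty)
qed

lemma cf_graph_half: "cf_graph [2] = concat_graph initial_graph initial_graph"
  using cf_graph_snoc_Suc[of "[]" 1]
  by (simp only: cf_graph_Nil cf_graph_one append_Nil) (simp add: numeral_2_eq_2)

lemma half_facts:
  "first_degree [2] = 2" "last_degree [2] = 2"
  "interior_count (cf_graph [2]) k = (if k = 2 then 1 else 0)"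
  using degree_concat_graph_first[of initial_graph initial_graph]
    degree_concat_graph_last[of initial_graph initial_graph]
    interior_count_concat_graph[of initial_graph initial_graph k]
  by (simp_all add: first_degree_def last_degree_def cf_graph_half initial_graph_facts
      initial_graph_facts(4)[unfolded One_nat_def])

text \<open>
  The boundary degree grows by one from the newer parent to the child: the child gains one at
  both ends, and the end it takes from the older parent has one edge less than the
  corresponding end of the newer parent.
\<close>

lemma boundary_degree_sum:
  assumes "below_half xs"
  shows "first_degree xs + last_degree xs = sum_list xs + 2"
  using assms
proof (induction rule: below_half_induct)
  case Nil
  then show ?case
    using initial_graph_facts by (simp add: first_degree_def last_degree_def cf_graph_Nil)
next
  case half
  then show ?case by (simp add: half_facts)
next
  case (mediant xs n)
  note deg = extreme_degrees_snoc_Suc[OF below_half_pos[OF mediant.hyps(2)]]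
    extreme_degrees_newer_parent[OF mediant.hyps(2)]
  show ?case
    using mediant.IH deg by (cases "even (length xs)") simp_all
next
  case (snoc_one xs n)
  then show ?case
    using cf_graph_snoc_one[of xs n] by (simp add: first_degree_def last_degree_def)
qed

text \<open>
  At the glued node, one end of the older parent \<open>xs\<close> meets an end of the newer one which has
  one edge more than the other end of \<open>xs\<close>. Its degree is thus the boundary degree of \<open>xs\<close> plus one.
\<close>

lemma interior_count_snoc_Suc:
  assumes "below_half xs" "below_half (xs @ [n])"
  shows "interior_count (cf_graph (xs @ [Suc n])) k =
    interior_count (cf_graph (xs @ [n])) k + interior_count (cf_graph xs) k
    + (if k = sum_list xs + 3 then 1 else 0)"
proof (cases "even (length xs)")
  case True
  then have "last_degree xs + first_degree (xs @ [n]) = sum_list xs + 3"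
    using extreme_degrees_newer_parent(1)[OF assms(2)] boundary_degree_sum[OF assms(1)] by simp
  then show ?thesis
    using True cf_graph_snoc_Suc[OF below_half_pos[OF assms(2)]]
    by (simp add: interior_count_concat_graph first_degree_def last_degree_def)
next
  case False
  then have "last_degree (xs @ [n]) + first_degree xs = sum_list xs + 3"
    using extreme_degrees_newer_parent(2)[OF assms(2)] boundary_degree_sum[OF assms(1)] by simp
  then show ?thesis
    using False cf_graph_snoc_Suc[OF below_half_pos[OF assms(2)]]
    by (simp add: interior_count_concat_graph first_degree_def last_degree_def)
qed


section \<open>The interior degrees in closed form\<close>

text \<open>
  The denominator of \<open>[a\<^bsub>l+1\<^esub> - 1, a\<^bsub>l+2\<^esub>, \<dots>, a\<^sub>m]\<close>; list positions start at \<open>0\<close>, so \<open>xs ! l\<close> is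
  \<open>a\<^bsub>l+1\<^esub>\<close>.
\<close>

definition tail_den :: "nat list \<Rightarrow> nat \<Rightarrow> nat" where
  "tail_den xs l = cf_den ((xs ! l - 1) # drop (Suc l) xs)"

text \<open>
  The predicted number of interior nodes of degree \<open>k\<close> among the hubs, the nodes glued when a
  convergent \<open>[a\<^sub>1, \<dots>, a\<^sub>l]\<close> with \<open>l \<ge> 1\<close> was the older parent.
\<close>

definition hub_count :: "nat list \<Rightarrow> nat \<Rightarrow> nat" where
  "hub_count xs k =
     (\<Sum>l\<in>{1..<length xs}. if k = sum_list (take l xs) + 3 then tail_den xs l else 0)"

lemma tail_den_snoc_Suc:
  assumes "l < length xs"
  shows "tail_den (xs @ [Suc n]) l = tail_den (xs @ [n]) l + tail_den xs l"
proof -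
  have "tail_den (xs @ [j]) l = cf_den (((xs ! l - 1) # drop (Suc l) xs) @ [j])" for j
    using assms by (simp add: tail_den_def nth_append)
  then show ?thesis
    by (simp only: cf_snoc_Suc) (simp add: tail_den_def)
qed

lemma tail_den_snoc_length: "tail_den (xs @ [n]) (length xs) = n - 1"
  by (simp add: tail_den_def)

text \<open>
  The summands with \<open>l < length xs\<close> are additive. The one with \<open>l = length xs\<close> is \<open>n - 1\<close> for
  \<open>xs @ [n]\<close>, absent for \<open>xs\<close>, and accounts for the extra node.
\<close>

lemma hub_count_snoc_Suc:
  assumes "xs \<noteq> []" "1 \<le> n"
  shows "hub_count (xs @ [Suc n]) k =
    hub_count (xs @ [n]) k + hub_count xs k + (if k = sum_list xs + 3 then 1 else 0)"
proof -
  have split: "hub_count (xs @ [j]) k =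
      (\<Sum>l\<in>{1..<length xs}. if k = sum_list (take l xs) + 3 then tail_den (xs @ [j]) l else 0)
      + (if k = sum_list xs + 3 then j - 1 else 0)" for j
  proof -
    have "1 \<le> length xs" using assms(1) by (cases xs) auto
    then have "{1..<length (xs @ [j])} = insert (length xs) {1..<length xs}" by auto
    then have "hub_count (xs @ [j]) k =
      (if k = sum_list (take (length xs) (xs @ [j])) + 3 then tail_den (xs @ [j]) (length xs) else 0) +
      (\<Sum>l\<in>{1..<length xs}. if k = sum_list (take l (xs @ [j])) + 3 then tail_den (xs @ [j]) l else 0)"
      by (simp add: hub_count_def)
    also have "(\<Sum>l\<in>{1..<length xs}. if k = sum_list (take l (xs @ [j])) + 3 then tail_den (xs @ [j]) l else 0)
       = (\<Sum>l\<in>{1..<length xs}. if k = sum_list (take l xs) + 3 then tail_den (xs @ [j]) l else 0)"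
      by (intro sum.cong) auto
    finally show ?thesis by (simp add: tail_den_snoc_length)
  qed
  have "(\<Sum>l\<in>{1..<length xs}. if k = sum_list (take l xs) + 3 then tail_den (xs @ [Suc n]) l else 0)
     = (\<Sum>l\<in>{1..<length xs}. if k = sum_list (take l xs) + 3 then tail_den (xs @ [n]) l else 0)
       + hub_count xs k"
    unfolding hub_count_def sum.distrib[symmetric]
    by (intro sum.cong) (auto simp: tail_den_snoc_Suc)
  then show ?thesis
    using assms(2) by (simp add: split)
qed

text \<open>
  The longer expansion has one more summand, which is the denominator of \<open>[0]\<close>, hence zero.
\<close>

lemma hub_count_snoc_one:
  assumes "1 \<le> n"
  shows "hub_count (xs @ [n, 1]) k = hub_count (xs @ [Suc n]) k"
proof -
  have "tail_den (xs @ [n, 1]) (Suc (length xs)) = 0"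
    by (simp add: tail_den_def nth_append)
  then have "hub_count (xs @ [n, 1]) k =
    (\<Sum>l\<in>{1..<length (xs @ [Suc n])}. if k = sum_list (take l (xs @ [n, 1])) + 3
       then tail_den (xs @ [n, 1]) l else 0)"
    unfolding hub_count_def
    by (intro sum.mono_neutral_right) (auto simp: less_Suc_eq)
  also have "\<dots> = hub_count (xs @ [Suc n]) k"
    unfolding hub_count_def
  proof (rule sum.cong[OF refl])
    fix l assume l: "l \<in> {1..<length (xs @ [Suc n])}"
    have "tail_den (xs @ [n, 1]) l = tail_den (xs @ [Suc n]) l"
    proof (cases "l = length xs")
      case True
      then show ?thesis using assms by (simp add: tail_den_def nth_append)
    next
      case False
      then have "l < length xs" using l by auto
      then show ?thesis
        using cf_snoc_one(2)[of "(xs ! l - 1) # drop (Suc l) xs" n]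
        by (simp add: tail_den_def nth_append)
    qed
    then show "(if k = sum_list (take l (xs @ [n, 1])) + 3 then tail_den (xs @ [n, 1]) l else 0) =
      (if k = sum_list (take l (xs @ [Suc n])) + 3 then tail_den (xs @ [Suc n]) l else 0)"
      using l by simp
  qed
  finally show ?thesis .
qed

text \<open>
  The correction for the empty list makes up for \<open>0/1\<close>, where \<open>q - 2 p = 1\<close> although there is no
  interior node. In the mediant step with the empty list this missing node is replaced by the
  glued node, of degree \<open>0 + 3\<close>, so that the counts \<open>q - 2 p\<close> are additive from there on.
\<close>

lemma interior_count_closed_form:
  assumes "below_half xs"
  shows "interior_count (cf_graph xs) k + (if xs = [] \<and> k = 3 then 1 else 0) =
    (if k = 2 then cf_num xs else 0) + (if k = 3 then cf_den xs - 2 * cf_num xs else 0)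
    + hub_count xs k"
  using assms
proof (induction rule: below_half_induct)
  case Nil
  then show ?case by (simp add: cf_graph_Nil initial_graph_facts hub_count_def)
next
  case half
  then show ?case by (simp add: half_facts hub_count_def)
next
  case (mediant xs n)
  note rec = interior_count_snoc_Suc[OF mediant.hyps, of k]
  note le = twice_cf_num_le_den[OF mediant.hyps(1)] twice_cf_num_le_den[OF mediant.hyps(2)]
  show ?case
  proof (cases "xs = []")
    case True
    then show ?thesis using mediant.IH rec le by (auto simp: hub_count_def)
  next
    case False
    then have "1 \<le> n" using mediant.hyps by (simp add: below_half_def)
    then show ?thesis
      using False mediant.IH rec le hub_count_snoc_Suc[OF False, of n k]
      by (auto simp: cf_snoc_Suc)
  qed
next
  case (snoc_one xs n)
  then have "1 \<le> n" by (simp add: below_half_def)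
  then show ?case
    using snoc_one.IH by (simp add: cf_graph_snoc_one cf_snoc_one hub_count_snoc_one
      del: One_nat_def)
qed


section \<open>The degree distribution\<close>

theorem theorem1:
  fixes p q m :: nat and a :: "nat \<Rightarrow> nat"
  assumes "coprime p q" and "0 < p" and "2 * p < q"
    and "1 \<le> m" and "\<forall>i \<in> {1..m}. 1 \<le> a i" and "2 \<le> a m"
    and "cf_value (map a [1..<m + 1]) = of_nat p / of_nat q"
  shows "degree_distribution 2 p q = of_nat p / of_nat q
     \<and> degree_distribution 3 p q = (of_nat q - 2 * of_nat p) / of_nat q
     \<and> degree_distribution 4 p q = 0
     \<and> (\<forall>l \<in> {1..m - 1}. degree_distribution ((\<Sum>i = 1..l. a i) + 3) p q =
           of_int (snd (quotient_of (cf_value ((a (l + 1) - 1) # map a [l + 2..<m + 1]))))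
             / of_nat q)
     \<and> degree_distribution ((\<Sum>i = 1..m. a i) + 2) p q = 1 / of_nat q
     \<and> (\<forall>k. k \<notin> {2, 3, 4} \<and> (\<forall>l \<in> {1..m - 1}. k \<noteq> (\<Sum>i = 1..l. a i) + 3)
           \<and> k \<noteq> (\<Sum>i = 1..m. a i) + 2 \<longrightarrow> degree_distribution k p q = 0)"
proof -
  define xs where "xs = map a [1..<m + 1]"
  define A where "A l = (\<Sum>i = 1..l. a i)" for l
  have len: "length xs = m" by (simp add: xs_def)
  have ne: "xs \<noteq> []" using assms(4) len by auto
  have pos: "\<forall>x\<in>set xs. 1 \<le> x" using assms(5) by (auto simp: xs_def)
  have nth: "xs ! l = a (l + 1)" if "l < m" for l
    using that by (simp add: xs_def del: upt_Suc)
  have "(of_nat (cf_num xs) / of_nat (cf_den xs) :: rat) = of_nat p / of_nat q"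
    using assms(7) cf_value_eq[OF pos] by (simp add: xs_def)
  then have "quotient_of (of_nat (cf_num xs) / of_nat (cf_den xs)) = quotient_of (of_nat p / of_nat q)"
    by (rule arg_cong)
  moreover have "0 < q" using assms(3) by simp
  ultimately have "(int (cf_num xs), int (cf_den xs)) = (int p, int q)"
    by (simp only: quotient_of_divide_nat coprime_cf cf_den_pos[OF pos] assms(1))
  then have p: "p = cf_num xs" and q: "q = cf_den xs" by auto
  have below: "below_half xs"
  proof -
    obtain x ys where Cons: "xs = x # ys" using ne by (cases xs) auto
    \<comment> \<open>\<open>[1, a\<^sub>2, \<dots>]\<close> is at least \<open>1/2\<close>.\<close>
    have "x \<noteq> 1"
    proof
      assume "x = 1"
      then have "q \<le> 2 * p" using cf_num_le_den[of ys] pos by (simp add: p q Cons)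
      then show False using assms(3) by simp
    qed
    then show ?thesis using pos Cons by (auto simp: below_half_def)
  qed
  have sum_take: "sum_list (take l xs) = A l" if "l \<le> m" for l
  proof -
    have "take l xs = map a [1..<l + 1]"
      using that by (simp add: xs_def take_map del: upt_Suc)
    then show ?thesis
      by (simp add: A_def interv_sum_list_conv_sum_set_nat atLeastLessThanSuc_atLeastAtMost del: upt_Suc)
  qed
  have sum_xs: "sum_list xs = A m" using sum_take[of m] len by simp
  have mono: "A l < A l'" if "l < l'" "l' \<le> m" for l l'
  proof -
    have "A l < A (l + j)" if "0 < j" "l + j \<le> m" for j
      using that
    proof (induction j)
      case (Suc j)
      have "1 \<le> a (l + Suc j)" using Suc.prems assms(5) by simp
      then show ?case using Suc by (cases "j = 0") (auto simp: A_def)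
    qed simp
    from this[of "l' - l"] that show ?thesis by simp
  qed
  have A_ge: "2 \<le> A l" if "1 \<le> l" "l \<le> m" for l
  proof -
    have "2 \<le> A 1" using below nth[of 0] assms(4) ne by (simp add: below_half_def A_def hd_conv_nth)
    then show ?thesis using mono[of 1 l] that by (cases "l = 1") auto
  qed
  have hub_at: "hub_count xs (A l + 3) = tail_den xs l" if "l \<in> {1..m - 1}" for l
  proof -
    have "A l + 3 = sum_list (take l' xs) + 3 \<longleftrightarrow> l' = l" if "l' \<in> {1..<m}" for l'
    proof (cases l l' rule: linorder_cases)
      case less
      then show ?thesis using that mono[of l l'] sum_take[of l'] by simp
    next
      case equal
      then show ?thesis using that sum_take[of l'] by simp
    next
      case greater
      have "l \<le> m" using \<open>l \<in> {1..m - 1}\<close> by auto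
      then show ?thesis using that greater mono[of l' l] sum_take[of l'] by simp
    qed
    then have "hub_count xs (A l + 3) = (\<Sum>l'\<in>{1..<m}. if l' = l then tail_den xs l' else 0)"
      by (auto simp: hub_count_def len intro!: sum.cong)
    also have "\<dots> = tail_den xs l" using that by auto
    finally show ?thesis .
  qed
  have hub_other: "hub_count xs k = 0" if "\<forall>l\<in>{1..m - 1}. k \<noteq> A l + 3" for k
    unfolding hub_count_def using that sum_take by (intro sum.neutral) (auto simp: len)
  \<comment> \<open>For \<open>m = 1\<close> this needs \<open>a\<^sub>1 \<ge> 3\<close>, which comes from \<open>p/q \<noteq> 1/2\<close>.\<close>
  have A_m: "5 \<le> A m + 2"
  proof (cases "m = 1")
    case True
    then have "xs = [a 1]" by (simp add: xs_def)
    then show ?thesis using assms(3) True by (simp add: p q A_def)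
  next
    case False
    then show ?thesis using mono[of 1 m] A_ge[of 1] assms(4) by simp
  qed
  \<comment> \<open>Here \<open>a\<^sub>m \<ge> 2\<close> matters: for \<open>a\<^sub>m = 1\<close> the two degrees would agree when \<open>l = m - 1\<close>.\<close>
  have A_m_ne: "A m + 2 \<noteq> A l + 3" if "l \<in> {1..m - 1}" for l
  proof -
    have "A m = A (m - 1) + a m" using assms(4) by (cases m) (simp_all add: A_def)
    moreover have "A l \<le> A (m - 1)" using mono[of l "m - 1"] that by (cases "l = m - 1") auto
    ultimately show ?thesis using assms(6) by simp
  qed
  have dist: "degree_distribution k p q = of_nat (
      (if k = 2 then p else 0) + (if k = 3 then q - 2 * p else 0) + hub_count xs k
      + (if k = A m + 2 then 1 else 0)) / of_nat q" for k
    using card_boundary_degree[of "cf_graph xs" k] interior_count_closed_form[OF below, of k]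
      boundary_degree_sum[OF below] ne sum_xs
    by (simp add: degree_distribution_def p q first_degree_def last_degree_def
        flip: cf_graph_def)
  have hub_small: "hub_count xs k = 0" if "k < 5" for k
    using that A_ge by (intro hub_other) fastforce
  have tail: "of_nat (tail_den xs l) =
      (of_int (snd (quotient_of (cf_value ((a (l + 1) - 1) # map a [l + 2..<m + 1])))) :: rat)"
    if l: "l \<in> {1..m - 1}" for l
  proof -
    let ?ys = "map a [l + 2..<m + 1]"
    have ys: "drop (Suc l) xs = ?ys" by (simp add: xs_def drop_map del: upt_Suc)
    have ys_pos: "\<forall>x\<in>set ?ys. 1 \<le> x" using assms(5) l by auto
    \<comment> \<open>The first entry may be zero, but then further entries follow.\<close>
    have "0 < cf_den ((a (l + 1) - 1) # ?ys)"
    proof (cases "l + 1 = m")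
      case True
      then show ?thesis using assms(6) by simp
    next
      case False
      then have "[l + 2..<m + 1] = (l + 2) # [Suc (l + 2)..<m + 1]"
        using l by (intro upt_conv_Cons) auto
      then have "0 < cf_num ?ys" using ys_pos cf_den_pos[of "map a [Suc (l + 2)..<m + 1]"]
        by (simp del: upt_Suc)
      then show ?thesis by (simp del: upt_Suc)
    qed
    moreover have "l < m" using l by auto
    then have "tail_den xs l = cf_den ((a (l + 1) - 1) # ?ys)"
      using nth[of l] by (simp add: tail_den_def ys del: upt_Suc cf_den.simps)
    ultimately show ?thesis
      by (simp only: cf_value_Cons_eq[OF ys_pos] quotient_of_divide_nat[OF coprime_cf] snd_conv of_int_of_nat_eq)
  qed
  have "degree_distribution 2 p q = of_nat p / of_nat q"
    using A_m by (simp add: dist hub_small)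
  moreover have "degree_distribution 3 p q = (of_nat q - 2 * of_nat p) / of_nat q"
    using A_m assms(3) by (simp add: dist hub_small of_nat_diff)
  moreover have "degree_distribution 4 p q = 0"
    using A_m by (simp add: dist hub_small)
  moreover have "\<forall>l \<in> {1..m - 1}. degree_distribution (A l + 3) p q =
      of_int (snd (quotient_of (cf_value ((a (l + 1) - 1) # map a [l + 2..<m + 1])))) / of_nat q"
  proof
    fix l assume l: "l \<in> {1..m - 1}"
    then have "2 \<le> A l" using A_ge by auto
    then have "degree_distribution (A l + 3) p q = of_nat (tail_den xs l) / of_nat q"
      using A_m_ne[OF l] hub_at[OF l] by (simp add: dist)
    then show "degree_distribution (A l + 3) p q =
      of_int (snd (quotient_of (cf_value ((a (l + 1) - 1) # map a [l + 2..<m + 1])))) / of_nat q"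
      by (simp only: tail[OF l])
  qed
  moreover have "degree_distribution (A m + 2) p q = 1 / of_nat q"
    using A_m A_m_ne hub_other[of "A m + 2"] by (simp add: dist)
  moreover have "\<forall>k. k \<notin> {2, 3, 4} \<and> (\<forall>l \<in> {1..m - 1}. k \<noteq> A l + 3) \<and> k \<noteq> A m + 2
      \<longrightarrow> degree_distribution k p q = 0"
    using hub_other by (simp add: dist)
  ultimately show ?thesis
    unfolding A_def by (intro conjI)
qed

end
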